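(* Let $R$ be a ring and let $I$ be an exchange ideal of $R$. Then the following are equivalent: (1) $I$ is square stable. (2) For any regular $a\in I$, $a\in a^2R$ and $aR$ is Dedekind-finite. (3) Every regular element in $I$ is strongly regular.
   Context: All rings are associative with identity and all ideals are two-sided. An ideal $I$ of a ring $R$ is square stable if whenever $aR+bR=R$ with $a\in I$ and $b\in R$, there exists $y\in R$ such that $a^2+by$ is a unit of $R$. An ideal $I$ of $R$ is an exchange ideal if for any $a\in I$ there exist an idempotent $e\in I$ and $x,y\in I$ such that $e=ax=a+y-ay$; equivalently (a known fact), for any $a\in I$ there exists an idempotent $e\in R$ such that $e\in aR$ and $1-e\in(1-a)R$. An element $a\in R$ is regular if $a=axa$ for some $x\in R$, and strongly regular if $a\in a^2R\cap Ra^2$. A right $R$-module $M$ is Dedekind-finite if its endomorphism ring $E$ is Dedekind-finite, i.e. $fg=1$ in $E$ implies $gf=1$. *)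

theory Defs
  imports "HOL-Algebra.Module" "HOL-Algebra.Ideal"
begin

text \<open>
  The locale \<open>ring\<close> of HOL-Algebra is neither commutative nor nontrivial by assumption, and
  \<open>ideal\<close> is two-sided. The sets \<open>aR\<close> and \<open>Ra\<close> are written \<open>a <# carrier R\<close> and
  \<open>carrier R #> a\<close>.
\<close>

definition ring_idempotent :: "('a, 'm) ring_scheme \<Rightarrow> 'a \<Rightarrow> bool" where
  "ring_idempotent R e \<longleftrightarrow> e \<in> carrier R \<and> e \<otimes>\<^bsub>R\<^esub> e = e"

definition ring_regular :: "('a, 'm) ring_scheme \<Rightarrow> 'a \<Rightarrow> bool" where
  "ring_regular R a \<longleftrightarrow>
     a \<in> carrier R \<and> (\<exists>x\<in>carrier R. a = a \<otimes>\<^bsub>R\<^esub> x \<otimes>\<^bsub>R\<^esub> a)"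

definition strongly_regular :: "('a, 'm) ring_scheme \<Rightarrow> 'a \<Rightarrow> bool" where
  "strongly_regular R a \<longleftrightarrow>
     a \<in> carrier R \<and>
     a \<in> ((a \<otimes>\<^bsub>R\<^esub> a) <#\<^bsub>R\<^esub> carrier R) \<inter> (carrier R #>\<^bsub>R\<^esub> (a \<otimes>\<^bsub>R\<^esub> a))"

definition square_stable :: "('a, 'm) ring_scheme \<Rightarrow> 'a set \<Rightarrow> bool" where
  "square_stable R I \<longleftrightarrow>
     (\<forall>a\<in>I. \<forall>b\<in>carrier R.
        (a <#\<^bsub>R\<^esub> carrier R) <+>\<^bsub>R\<^esub> (b <#\<^bsub>R\<^esub> carrier R) = carrier R \<longrightarrow>
        (\<exists>y\<in>carrier R. a \<otimes>\<^bsub>R\<^esub> a \<oplus>\<^bsub>R\<^esub> b \<otimes>\<^bsub>R\<^esub> y \<in> Units R))"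

locale exchange_ideal = ideal +
  assumes exchange:
    "a \<in> I \<Longrightarrow> \<exists>e x y. e \<in> I \<and> x \<in> I \<and> y \<in> I \<and> ring_idempotent R e \<and>
       e = a \<otimes> x \<and> a \<otimes> x = a \<oplus> y \<ominus> a \<otimes> y"

text \<open>
  The library's \<open>module\<close> locale requires a commutative ring. For right modules its record type
  is reused, with \<open>r \<odot> m\<close> standing for \<open>m r\<close>; this is what reverses the order of the
  scalars in \<open>smult_assoc\<close>. The fields \<open>mult\<close> and \<open>one\<close> of the record play no role.
\<close>

locale right_module = R?: ring R + M?: abelian_group M
  for R (structure) and M (structure) +
  assumes smult_closed:
      "\<lbrakk>r \<in> carrier R; m \<in> carrier M\<rbrakk> \<Longrightarrow> r \<odot>\<^bsub>M\<^esub> m \<in> carrier M"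
    and smult_l_distr:
      "\<lbrakk>r \<in> carrier R; s \<in> carrier R; m \<in> carrier M\<rbrakk> \<Longrightarrow>
       (r \<oplus> s) \<odot>\<^bsub>M\<^esub> m = r \<odot>\<^bsub>M\<^esub> m \<oplus>\<^bsub>M\<^esub> s \<odot>\<^bsub>M\<^esub> m"
    and smult_r_distr:
      "\<lbrakk>r \<in> carrier R; m \<in> carrier M; n \<in> carrier M\<rbrakk> \<Longrightarrow>
       r \<odot>\<^bsub>M\<^esub> (m \<oplus>\<^bsub>M\<^esub> n) = r \<odot>\<^bsub>M\<^esub> m \<oplus>\<^bsub>M\<^esub> r \<odot>\<^bsub>M\<^esub> n"
    and smult_assoc:
      "\<lbrakk>r \<in> carrier R; s \<in> carrier R; m \<in> carrier M\<rbrakk> \<Longrightarrow>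
       (r \<otimes> s) \<odot>\<^bsub>M\<^esub> m = s \<odot>\<^bsub>M\<^esub> (r \<odot>\<^bsub>M\<^esub> m)"
    and smult_one: "m \<in> carrier M \<Longrightarrow> \<one> \<odot>\<^bsub>M\<^esub> m = m"

text \<open>
  Endomorphisms are extensional functions (\<open>\<rightarrow>\<^sub>E\<close>), so that equality in the endomorphism
  ring is equality on the carrier of \<open>M\<close>.
\<close>

definition module_endos :: "('a, 'm) ring_scheme \<Rightarrow> ('a, 'b, 'n) module_scheme \<Rightarrow> ('b \<Rightarrow> 'b) set"
  where
  "module_endos R M =
     {f \<in> carrier M \<rightarrow>\<^sub>E carrier M.
        (\<forall>m\<in>carrier M. \<forall>n\<in>carrier M. f (m \<oplus>\<^bsub>M\<^esub> n) = f m \<oplus>\<^bsub>M\<^esub> f n) \<and>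
        (\<forall>r\<in>carrier R. \<forall>m\<in>carrier M. f (r \<odot>\<^bsub>M\<^esub> m) = r \<odot>\<^bsub>M\<^esub> f m)}"

definition endo_ring :: "('a, 'm) ring_scheme \<Rightarrow> ('a, 'b, 'n) module_scheme \<Rightarrow> ('b \<Rightarrow> 'b) ring"
  where
  "endo_ring R M =
     \<lparr>carrier = module_endos R M,
      mult = compose (carrier M),
      one = (\<lambda>m\<in>carrier M. m),
      zero = (\<lambda>m\<in>carrier M. \<zero>\<^bsub>M\<^esub>),
      add = (\<lambda>f g. \<lambda>m\<in>carrier M. f m \<oplus>\<^bsub>M\<^esub> g m)\<rparr>"

definition dedekind_finite_ring :: "('a, 'm) ring_scheme \<Rightarrow> bool" where
  "dedekind_finite_ring E \<longleftrightarrow>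
     (\<forall>f\<in>carrier E. \<forall>g\<in>carrier E. f \<otimes>\<^bsub>E\<^esub> g = \<one>\<^bsub>E\<^esub> \<longrightarrow> g \<otimes>\<^bsub>E\<^esub> f = \<one>\<^bsub>E\<^esub>)"

definition dedekind_finite_module ::
    "('a, 'm) ring_scheme \<Rightarrow> ('a, 'b, 'n) module_scheme \<Rightarrow> bool" where
  "dedekind_finite_module R M \<longleftrightarrow> dedekind_finite_ring (endo_ring R M)"

definition principal_right_module :: "('a, 'm) ring_scheme \<Rightarrow> 'a \<Rightarrow> ('a, 'a) module" where
  "principal_right_module R a =
     \<lparr>carrier = a <#\<^bsub>R\<^esub> carrier R, mult = mult R, one = one R, zero = zero R, add = add R,
      smult = (\<lambda>r m. m \<otimes>\<^bsub>R\<^esub> r)\<rparr>"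

lemma (in ring) right_module_principal:
  assumes a: "a \<in> carrier R"
  shows "right_module R (principal_right_module R a)" (is "right_module R ?M")
proof -
  have c: "m \<in> carrier ?M \<longleftrightarrow> (\<exists>r\<in>carrier R. m = a \<otimes> r)" for m
    by (auto simp: principal_right_module_def l_coset_def)
  have cR: "m \<in> carrier R" if "m \<in> carrier ?M" for m
    using that a by (auto simp: c)
  have ops [simp]: "add ?M = add R" "zero ?M = zero R" "smult ?M = (\<lambda>r m. m \<otimes> r)"
    by (simp_all add: principal_right_module_def)
  have "abelian_group ?M"
  proof (rule abelian_groupI)
    show "m \<oplus>\<^bsub>?M\<^esub> n \<in> carrier ?M" if mn: "m \<in> carrier ?M" "n \<in> carrier ?M" for m n
    proof -
      from mn obtain r s where "r \<in> carrier R" "m = a \<otimes> r" "s \<in> carrier R" "n = a \<otimes> s"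
        by (auto simp: c)
      then show ?thesis using a by (auto simp: c r_distr intro!: bexI[of _ "r \<oplus> s"])
    qed
    show "\<zero>\<^bsub>?M\<^esub> \<in> carrier ?M" using a by (auto simp: c intro!: bexI[of _ \<zero>])
    show "\<exists>n\<in>carrier ?M. n \<oplus>\<^bsub>?M\<^esub> m = \<zero>\<^bsub>?M\<^esub>" if "m \<in> carrier ?M" for m
    proof -
      from that obtain r where r: "r \<in> carrier R" "m = a \<otimes> r" by (auto simp: c)
      then have "a \<otimes> (\<ominus> r) \<in> carrier ?M" by (auto simp: c)
      then show ?thesis using r a by (intro bexI[of _ "a \<otimes> (\<ominus> r)"]) (auto simp: r_minus l_neg)
    qed
  qed (use cR in \<open>auto intro: a_assoc a_comm\<close>)
  moreover have "right_module_axioms R ?M"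
  proof
    show "r \<odot>\<^bsub>?M\<^esub> m \<in> carrier ?M" if "r \<in> carrier R" "m \<in> carrier ?M" for r m
      using that a by (auto simp: c m_assoc)
  qed (simp_all add: cR l_distr r_distr m_assoc)
  ultimately show ?thesis by (intro right_module.intro ring_axioms)
qed

lemma (in right_module) smult_zero: "r \<in> carrier R \<Longrightarrow> r \<odot>\<^bsub>M\<^esub> \<zero>\<^bsub>M\<^esub> = \<zero>\<^bsub>M\<^esub>"
  by (metis M.add.r_cancel_one' M.r_zero M.zero_closed smult_closed smult_r_distr)

lemma (in right_module) smult_minus:
  assumes "r \<in> carrier R" "m \<in> carrier M"
  shows "r \<odot>\<^bsub>M\<^esub> (\<ominus>\<^bsub>M\<^esub> m) = \<ominus>\<^bsub>M\<^esub> (r \<odot>\<^bsub>M\<^esub> m)"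
  by (metis assms smult_zero smult_r_distr smult_closed M.a_inv_closed M.l_neg M.minus_equality)

lemma (in right_module) ring_endo_ring: "ring (endo_ring R M)"
proof (rule ringI)
  note defs = endo_ring_def module_endos_def
  have ext: "f = g" if "f \<in> carrier (endo_ring R M)" "g \<in> carrier (endo_ring R M)"
    "\<And>m. m \<in> carrier M \<Longrightarrow> f m = g m" for f g
  proof (rule PiE_ext)
    show "f \<in> carrier M \<rightarrow>\<^sub>E carrier M" "g \<in> carrier M \<rightarrow>\<^sub>E carrier M"
      using that(1,2) by (simp_all add: defs)
  qed (rule that(3))
  have cl: "f m \<in> carrier M" if "f \<in> carrier (endo_ring R M)" "m \<in> carrier M" for f m
    using that by (auto simp: defs)
  have hom_add: "f (m \<oplus>\<^bsub>M\<^esub> n) = f m \<oplus>\<^bsub>M\<^esub> f n"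
    if "f \<in> carrier (endo_ring R M)" "m \<in> carrier M" "n \<in> carrier M" for f m n
    using that by (auto simp: defs)
  have hom_smult: "f (r \<odot>\<^bsub>M\<^esub> m) = r \<odot>\<^bsub>M\<^esub> f m"
    if "f \<in> carrier (endo_ring R M)" "r \<in> carrier R" "m \<in> carrier M" for f r m
    using that by (auto simp: defs)
  have add_cl: "f \<oplus>\<^bsub>endo_ring R M\<^esub> g \<in> carrier (endo_ring R M)"
    if fg: "f \<in> carrier (endo_ring R M)" "g \<in> carrier (endo_ring R M)" for f g
    using cl[OF fg(1)] cl[OF fg(2)] hom_add[OF fg(1)] hom_add[OF fg(2)]
      hom_smult[OF fg(1)] hom_smult[OF fg(2)]
    by (simp add: defs M.a_ac smult_r_distr smult_closed)
  have mult_cl: "f \<otimes>\<^bsub>endo_ring R M\<^esub> g \<in> carrier (endo_ring R M)"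
    if fg: "f \<in> carrier (endo_ring R M)" "g \<in> carrier (endo_ring R M)" for f g
    using cl[OF fg(1)] cl[OF fg(2)] hom_add[OF fg(1)] hom_add[OF fg(2)]
      hom_smult[OF fg(1)] hom_smult[OF fg(2)]
    by (simp add: defs compose_def smult_closed)
  have zero_cl: "\<zero>\<^bsub>endo_ring R M\<^esub> \<in> carrier (endo_ring R M)"
    by (simp add: defs smult_zero smult_closed)
  have one_cl: "\<one>\<^bsub>endo_ring R M\<^esub> \<in> carrier (endo_ring R M)"
    by (simp add: defs smult_closed)
  have neg_cl: "(\<lambda>m\<in>carrier M. \<ominus>\<^bsub>M\<^esub> f m) \<in> carrier (endo_ring R M)"
    if f: "f \<in> carrier (endo_ring R M)" for f
    using cl[OF f] hom_add[OF f] hom_smult[OF f]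
    by (simp add: defs smult_closed smult_minus M.minus_add)
  have add_ap: "(f \<oplus>\<^bsub>endo_ring R M\<^esub> g) m = f m \<oplus>\<^bsub>M\<^esub> g m" if "m \<in> carrier M" for f g m
    using that by (simp add: endo_ring_def)
  have mult_ap: "(f \<otimes>\<^bsub>endo_ring R M\<^esub> g) m = f (g m)" if "m \<in> carrier M" for f g m
    using that by (simp add: endo_ring_def compose_def)
  have zero_ap: "\<zero>\<^bsub>endo_ring R M\<^esub> m = \<zero>\<^bsub>M\<^esub>" if "m \<in> carrier M" for m
    using that by (simp add: endo_ring_def)
  have one_ap: "\<one>\<^bsub>endo_ring R M\<^esub> m = m" if "m \<in> carrier M" for m
    using that by (simp add: endo_ring_def)
  note aps = add_ap mult_ap zero_ap one_ap
  note cls = add_cl mult_cl zero_cl one_cl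
  show "abelian_group (endo_ring R M)"
  proof (rule abelian_groupI)
    show "\<exists>g\<in>carrier (endo_ring R M). g \<oplus>\<^bsub>endo_ring R M\<^esub> f = \<zero>\<^bsub>endo_ring R M\<^esub>"
      if "f \<in> carrier (endo_ring R M)" for f
      using that
      by (intro bexI[OF _ neg_cl[OF that]] ext) (auto simp: aps cls cl neg_cl M.l_neg)
  qed (auto intro!: ext simp: aps cls cl M.a_ac)
  show "monoid (endo_ring R M)"
    by (rule monoidI) (auto intro!: ext simp: aps cls cl)
  fix f g h
  assume "f \<in> carrier (endo_ring R M)" "g \<in> carrier (endo_ring R M)" "h \<in> carrier (endo_ring R M)"
  then show "(f \<oplus>\<^bsub>endo_ring R M\<^esub> g) \<otimes>\<^bsub>endo_ring R M\<^esub> h =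
        f \<otimes>\<^bsub>endo_ring R M\<^esub> h \<oplus>\<^bsub>endo_ring R M\<^esub> g \<otimes>\<^bsub>endo_ring R M\<^esub> h"
      "h \<otimes>\<^bsub>endo_ring R M\<^esub> (f \<oplus>\<^bsub>endo_ring R M\<^esub> g) =
        h \<otimes>\<^bsub>endo_ring R M\<^esub> f \<oplus>\<^bsub>endo_ring R M\<^esub> h \<otimes>\<^bsub>endo_ring R M\<^esub> g"
    by (auto intro!: ext simp: aps cls cl hom_add)
qed

end

theory Submission
  imports Defs
begin

text \<open>
  All three conditions are equivalent to the following one: every regular \<open>a \<in> I\<close> lies in
  \<open>a\<^sup>2R\<close>. This is the first half of (2) and one half of (3), so what has to be shown
  is that this one-sided condition carries the rest of (2) and (3) with it and that it
  characterises square stability.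

  The condition yields Dedekind-finiteness of every corner \<open>eRe\<close> with an idempotent
  \<open>e \<in> I\<close> (\<open>corner_dedekind_finite\<close>): if \<open>fg = e\<close>, then \<open>g\<close> is regular, so
  \<open>g = g\<^sup>2z\<close>; multiplying by \<open>f\<close> gives \<open>e = gz\<close>, so \<open>g\<close> has inverses on both sides.
  For regular \<open>a = axa \<in> I\<close> and \<open>e = ax\<close> one has \<open>aR = eR\<close>. The endomorphisms of \<open>aR\<close> are
  therefore left multiplications by elements of \<open>eRe\<close>, which settles (2); and \<open>a \<in> a\<^sup>2R\<close>
  says that \<open>ae\<close> is right invertible in \<open>eRe\<close>, hence invertible, which gives
  \<open>a \<in> Ra\<^sup>2\<close> and so (3).

  If \<open>I\<close> is square stable and \<open>a = axa\<close>, then \<open>aR + (1 - ax)R = R\<close>, so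
  \<open>u = a\<^sup>2 + (1 - ax)y\<close> is a unit for some \<open>y\<close>. Multiplying by \<open>ax\<close> removes the second
  summand, and \<open>a = axuu\<^sup>-\<^sup>1a = a\<^sup>2u\<^sup>-\<^sup>1a\<close>.

  For the converse let \<open>aR + bR = R\<close>. Exchange provides an idempotent \<open>e \<in> I \<inter> aR\<close> with
  \<open>1 - e \<in> bR\<close>, and it is enough that \<open>d = ea\<^sup>2\<close> satisfies \<open>d + (1 - e) \<in> R\<^sup>\<times>\<close>, because
  \<open>d + (1 - e) = a\<^sup>2 + (1 - e)(1 - a\<^sup>2)\<close>. The difficulty is to see that \<open>dR = eR\<close>
  (\<open>idempotent_in_square\<close>). In block form with respect to \<open>e\<close> and \<open>1 - e\<close> let the first row of
  \<open>a\<close> be \<open>(\<alpha>, \<beta>)\<close> and its first column be \<open>(\<alpha>, \<gamma>)\<close>. The hypothesis makes \<open>\<alpha>\<close> right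
  invertible for every choice of a complement of \<open>(1 - e)R\<close>, not only for \<open>eR\<close>; the complement
  spanned by the column \<open>(1, \<gamma>\<alpha>\<^sup>-\<^sup>1)\<close> turns \<open>\<alpha>\<close> into
  \<open>\<alpha> + \<beta>\<gamma>\<alpha>\<^sup>-\<^sup>1 = (\<alpha>\<^sup>2 + \<beta>\<gamma>)\<alpha>\<^sup>-\<^sup>1\<close>, and \<open>\<alpha>\<^sup>2 + \<beta>\<gamma>\<close> is the corner \<open>ea\<^sup>2e\<close>. Once
  \<open>dR = eR\<close> is known, \<open>de\<close> is invertible in \<open>eRe\<close> and \<open>d + (1 - e)\<close> is block triangular with
  invertible diagonal (\<open>complete_to_unit\<close>).
\<close>

section \<open>One-sided ideals and idempotents\<close>

lemma (in ring) mem_l_coset_carrier_iff: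
  "b \<in> a <# carrier R \<longleftrightarrow> (\<exists>r\<in>carrier R. b = a \<otimes> r)"
  by (auto simp: l_coset_def)

lemma (in ring) mem_r_coset_carrier_iff:
  "b \<in> carrier R #> a \<longleftrightarrow> (\<exists>r\<in>carrier R. b = r \<otimes> a)"
  by (auto simp: r_coset_def)

lemma (in ring) right_ideals_comaximal_iff:
  assumes a: "a \<in> carrier R" and b: "b \<in> carrier R"
  shows "(a <# carrier R) <+> (b <# carrier R) = carrier R \<longleftrightarrow>
    (\<exists>x\<in>carrier R. \<exists>y\<in>carrier R. \<one> = a \<otimes> x \<oplus> b \<otimes> y)" (is "?S = _ \<longleftrightarrow> ?B")
proof
  have mem: "r \<in> ?S \<longleftrightarrow> (\<exists>x\<in>carrier R. \<exists>y\<in>carrier R. r = a \<otimes> x \<oplus> b \<otimes> y)" for r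
    unfolding set_add_def' mem_Collect_eq by (auto simp: l_coset_def)
  show ?B if "?S = carrier R"
    using mem[of \<one>] that by simp
  assume ?B
  then obtain x y where xy: "x \<in> carrier R" "y \<in> carrier R" "\<one> = a \<otimes> x \<oplus> b \<otimes> y" by blast
  have "r \<in> ?S" if r: "r \<in> carrier R" for r
  proof -
    have "r = (a \<otimes> x \<oplus> b \<otimes> y) \<otimes> r" using r by (simp flip: xy(3))
    also have "\<dots> = a \<otimes> (x \<otimes> r) \<oplus> b \<otimes> (y \<otimes> r)"
      using a b xy(1,2) r by (simp add: l_distr m_assoc)
    finally show ?thesis unfolding mem using xy(1,2) r by blast
  qed
  moreover have "?S \<subseteq> carrier R" using a b by (auto simp: mem)
  ultimately show "?S = carrier R" by blast
qed

lemma (in ring) add_one_minus: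
  assumes "e \<in> carrier R"
  shows "e \<oplus> (\<one> \<ominus> e) = \<one>"
  unfolding a_minus_def using assms
  by (metis a_comm a_inv_closed a_lcomm l_neg one_closed r_zero)

lemma (in ring) idempotent_one_minus:
  assumes "e \<in> carrier R" "e \<otimes> e = e"
  shows "e \<otimes> (\<one> \<ominus> e) = \<zero>" "(\<one> \<ominus> e) \<otimes> e = \<zero>"
    "(\<one> \<ominus> e) \<otimes> (\<one> \<ominus> e) = \<one> \<ominus> e"
  using assms by (simp_all add: a_minus_def r_distr l_distr r_minus l_minus r_neg)

section \<open>Ideals whose regular elements are divisible by their squares\<close>

locale regulars_square_divisible = ideal +
  assumes regular_in_square: "\<lbrakk>a \<in> I; ring_regular R a\<rbrakk> \<Longrightarrow> \<exists>r\<in>carrier R. a = a \<otimes> a \<otimes> r"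
begin

text \<open>
  The right inverse \<open>g\<close>, not \<open>f\<close>, is the element to which divisibility by the square is applied:
  cancelling \<open>f\<close> on the left in \<open>g = g\<^sup>2z\<close> makes \<open>g\<close> right invertible as well.
\<close>

lemma corner_dedekind_finite:
  assumes eI: "e \<in> I" and fc: "f \<in> carrier R" and gc: "g \<in> carrier R"
    and fe: "f \<otimes> e = f" and eg: "e \<otimes> g = g" and ge: "g \<otimes> e = g" and fg: "f \<otimes> g = e"
  shows "g \<otimes> f = e"
proof -
  have ec: "e \<in> carrier R" using eI a_subset by blast
  have "g \<in> I" using I_r_closed[OF eI gc] eg by simp
  moreover have "g = g \<otimes> f \<otimes> g" using fc gc ec fg ge by (simp add: m_assoc)
  then have "ring_regular R g" using fc gc unfolding ring_regular_def by blast
  ultimately obtain z where z: "z \<in> carrier R" "g = g \<otimes> g \<otimes> z" using regular_in_square by blast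
  have "f \<otimes> g = (f \<otimes> g) \<otimes> g \<otimes> z" using z fc gc by (metis m_assoc m_closed)
  then have gz: "g \<otimes> z = e" using fg eg by simp
  have "f = e \<otimes> z" using fe gz fg fc gc z(1) by (metis m_assoc)
  then show ?thesis using gz ge gc ec z(1) by (metis m_assoc)
qed

text \<open>
  With \<open>e = ax\<close> the element \<open>ae\<close> of the corner \<open>eRe\<close> has a right inverse \<open>g\<close>, obtained
  from \<open>a = a\<^sup>2w\<close>. By Dedekind-finiteness \<open>g\<close> is a left inverse too, and \<open>a = gaea = ga\<^sup>2\<close>.
\<close>

lemma regular_in_left_square:
  assumes aI: "a \<in> I" and reg: "ring_regular R a"
  shows "\<exists>r\<in>carrier R. a = r \<otimes> (a \<otimes> a)"
proof -
  have ac: "a \<in> carrier R" using aI a_subset by blast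
  obtain x where x: "x \<in> carrier R" "a = a \<otimes> x \<otimes> a" using reg unfolding ring_regular_def by blast
  obtain w where w: "w \<in> carrier R" "a = a \<otimes> a \<otimes> w" using regular_in_square[OF aI reg] by blast
  define e where "e = a \<otimes> x"
  have eI: "e \<in> I" and ec: "e \<in> carrier R" using aI ac x(1) I_r_closed unfolding e_def by auto
  have ea: "e \<otimes> a = a" using x unfolding e_def by simp
  have ee: "e \<otimes> e = e" using ea ac ec x(1) unfolding e_def by (metis m_assoc)
  have e: "e = a \<otimes> (a \<otimes> (w \<otimes> x))" using w ac x(1) unfolding e_def by (metis m_assoc m_closed)
  define f where "f = a \<otimes> e"
  define g where "g = a \<otimes> (w \<otimes> (x \<otimes> e))"
  have fg: "f \<otimes> g = e"
  proof -
    have "f \<otimes> g = a \<otimes> ((e \<otimes> a) \<otimes> (w \<otimes> (x \<otimes> e)))"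
      using ac ec w(1) x(1) unfolding f_def g_def by (simp add: m_assoc)
    also have "\<dots> = (a \<otimes> (a \<otimes> (w \<otimes> x))) \<otimes> e" using ac ec w(1) x(1) ea by (simp add: m_assoc)
    finally show ?thesis using e ee by simp
  qed
  have fc: "f \<in> carrier R" and gc: "g \<in> carrier R"
    using ac ec w(1) x(1) unfolding f_def g_def by auto
  have "f \<otimes> e = f" "g \<otimes> e = g"
    using ac ec w(1) x(1) ee unfolding f_def g_def by (simp_all add: m_assoc)
  moreover have "e \<otimes> g = g" using ac ec w(1) x(1) ea unfolding g_def by (metis m_assoc m_closed)
  ultimately have gf: "g \<otimes> f = e" using corner_dedekind_finite eI fc gc fg by blast
  have "a = g \<otimes> f \<otimes> a" using gf ea by simp
  also have "\<dots> = g \<otimes> (a \<otimes> (e \<otimes> a))" using gc ac ec unfolding f_def by (simp add: m_assoc)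
  finally show ?thesis using ea gc by auto
qed

text \<open>
  As \<open>aR = eR\<close> with the idempotent \<open>e = ax\<close>, an endomorphism is determined by its value at \<open>e\<close>,
  which lies in \<open>eRe\<close>. Composition corresponds to multiplication of these values.
\<close>

lemma dedekind_finite_principal:
  assumes aI: "a \<in> I" and reg: "ring_regular R a"
  shows "dedekind_finite_module R (principal_right_module R a)" (is "dedekind_finite_module R ?M")
  unfolding dedekind_finite_module_def dedekind_finite_ring_def
proof (intro ballI impI)
  fix \<phi> \<gamma>
  assume \<phi>: "\<phi> \<in> carrier (endo_ring R ?M)" and \<gamma>: "\<gamma> \<in> carrier (endo_ring R ?M)"
    and inv: "\<phi> \<otimes>\<^bsub>endo_ring R ?M\<^esub> \<gamma> = \<one>\<^bsub>endo_ring R ?M\<^esub>"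
  have ac: "a \<in> carrier R" using aI a_subset by blast
  obtain x where x: "x \<in> carrier R" "a = a \<otimes> x \<otimes> a" using reg unfolding ring_regular_def by blast
  define e where "e = a \<otimes> x"
  have eI: "e \<in> I" and ec: "e \<in> carrier R" using aI ac x(1) I_r_closed unfolding e_def by auto
  have ea: "e \<otimes> a = a" using x unfolding e_def by simp
  have ee: "e \<otimes> e = e" using ea ac ec x(1) unfolding e_def by (metis m_assoc)
  have M: "m \<in> carrier ?M \<longleftrightarrow> (\<exists>r\<in>carrier R. m = a \<otimes> r)" for m
    by (simp add: principal_right_module_def mem_l_coset_carrier_iff)
  have MD: "m \<in> carrier R \<and> e \<otimes> m = m" if "m \<in> carrier ?M" for m
    using that ac ec ea unfolding M by (metis m_assoc m_closed)
  have eM: "e \<in> carrier ?M" using x(1) unfolding M e_def by blast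
  have left_mult: "h m = h e \<otimes> m" and maps: "h m \<in> carrier ?M"
    if h: "h \<in> carrier (endo_ring R ?M)" and m: "m \<in> carrier ?M" for h m
  proof -
    show "h m \<in> carrier ?M" using h m by (auto simp: endo_ring_def module_endos_def)
    have "h (m \<odot>\<^bsub>?M\<^esub> e) = m \<odot>\<^bsub>?M\<^esub> h e"
      using h MD[OF m] eM by (simp add: endo_ring_def module_endos_def)
    then show "h m = h e \<otimes> m" using MD[OF m] by (simp add: principal_right_module_def)
  qed
  have \<phi>e: "\<phi> e \<in> carrier R" "e \<otimes> \<phi> e = \<phi> e" "\<phi> e \<otimes> e = \<phi> e"
    using MD[OF maps[OF \<phi> eM]] left_mult[OF \<phi> eM] by auto
  have \<gamma>e: "\<gamma> e \<in> carrier R" "e \<otimes> \<gamma> e = \<gamma> e" "\<gamma> e \<otimes> e = \<gamma> e"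
    using MD[OF maps[OF \<gamma> eM]] left_mult[OF \<gamma> eM] by auto
  have "(\<phi> \<otimes>\<^bsub>endo_ring R ?M\<^esub> \<gamma>) e = e"
    unfolding inv using eM by (simp add: endo_ring_def)
  then have "\<phi> (\<gamma> e) = e" using eM by (simp add: endo_ring_def compose_def)
  then have "\<phi> e \<otimes> \<gamma> e = e" using left_mult[OF \<phi> maps[OF \<gamma> eM]] by simp
  then have \<gamma>\<phi>: "\<gamma> e \<otimes> \<phi> e = e"
    using corner_dedekind_finite[OF eI] \<phi>e \<gamma>e by blast
  have "\<gamma> (\<phi> m) = m" if m: "m \<in> carrier ?M" for m
  proof -
    have "\<gamma> (\<phi> m) = \<gamma> e \<otimes> (\<phi> e \<otimes> m)"
      using left_mult[OF \<gamma> maps[OF \<phi> m]] left_mult[OF \<phi> m] by simp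
    also have "\<dots> = e \<otimes> m" using \<gamma>\<phi> \<phi>e(1) \<gamma>e(1) MD[OF m] by (metis m_assoc)
    finally show ?thesis using MD[OF m] by simp
  qed
  then show "\<gamma> \<otimes>\<^bsub>endo_ring R ?M\<^esub> \<phi> = \<one>\<^bsub>endo_ring R ?M\<^esub>"
    by (auto simp: endo_ring_def compose_def)
qed

text \<open>
  If \<open>aR\<close> contains the idempotent \<open>e\<close>, then \<open>ea\<^sup>2R = eR\<close>. The trick is to use
  the hypothesis twice. Applied to \<open>ea\<close> it produces \<open>t \<in> eRe\<close> with \<open>eat = e\<close>. Then
  \<open>g = at\<close> is another idempotent, with \<open>eg = e\<close>, and \<open>gaR = gR\<close> since
  \<open>gas = ge = g\<close>; applied to \<open>ga\<close> the hypothesis gives \<open>g \<in> gagaR\<close>, so \<open>e = eg \<in> eagaR = ea\<cdot>at\<cdot>aR \<subseteq> ea\<^sup>2R\<close>.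
\<close>

lemma idempotent_in_square:
  assumes aI: "a \<in> I" and ec: "e \<in> carrier R" and ee: "e \<otimes> e = e"
    and sc: "s \<in> carrier R" and as: "a \<otimes> s = e"
  shows "\<exists>z\<in>carrier R. e \<otimes> (a \<otimes> a) \<otimes> z = e"
proof -
  have ac: "a \<in> carrier R" using aI a_subset by blast
  define c where "c = e \<otimes> a"
  have cI: "c \<in> I" and cc: "c \<in> carrier R" using aI ac ec I_l_closed unfolding c_def by auto
  have cs: "c \<otimes> s = e" using ac ec sc as ee unfolding c_def by (simp add: m_assoc)
  have ec': "e \<otimes> c = c" using ac ec ee unfolding c_def by (metis m_assoc)
  have "c = c \<otimes> s \<otimes> c" using cs ec' by simp
  then have "ring_regular R c" using cc sc unfolding ring_regular_def by blast
  then obtain r where r: "r \<in> carrier R" "c = c \<otimes> c \<otimes> r" using regular_in_square cI by blast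
  \<comment> \<open>The witness comes from \<open>e = cs = c\<^sup>2rs\<close>: split off one factor \<open>c = ea\<close> and cut the rest down
    to the corner.\<close>
  define t where "t = e \<otimes> (a \<otimes> (r \<otimes> (s \<otimes> e)))"
  have tc: "t \<in> carrier R" using ac ec r(1) sc unfolding t_def by simp
  have te: "t \<otimes> e = t" using ac ec r(1) sc ee unfolding t_def by (simp add: m_assoc)
  have ct: "c \<otimes> t = e"
  proof -
    have "c \<otimes> t = (c \<otimes> c \<otimes> r) \<otimes> (s \<otimes> e)"
      using ac ec r(1) sc unfolding c_def t_def by (simp add: m_assoc)
    also have "\<dots> = c \<otimes> s \<otimes> e" using r(2) cc sc ec by (simp add: m_assoc)
    finally show ?thesis using cs ee by simp
  qed
  define g where "g = a \<otimes> t"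
  have gc: "g \<in> carrier R" using ac tc unfolding g_def by simp
  have gg: "g \<otimes> g = g"
  proof -
    have "g \<otimes> g = a \<otimes> ((t \<otimes> e) \<otimes> (a \<otimes> t))" using ac tc te unfolding g_def by (simp add: m_assoc)
    also have "\<dots> = a \<otimes> (t \<otimes> (c \<otimes> t))" using ac tc ec unfolding c_def by (simp add: m_assoc)
    finally show ?thesis using ct te unfolding g_def by simp
  qed
  have eg: "e \<otimes> g = e" using ct ac ec tc unfolding g_def c_def by (simp add: m_assoc)
  have gas: "g \<otimes> a \<otimes> s = g" using ac gc sc tc ec as te unfolding g_def by (simp add: m_assoc)
  have "g \<otimes> a = (g \<otimes> a) \<otimes> s \<otimes> (g \<otimes> a)" using gas gg gc ac by (metis m_assoc)
  then have "ring_regular R (g \<otimes> a)" using gc ac sc unfolding ring_regular_def by blast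
  then obtain p where p: "p \<in> carrier R" "g \<otimes> a = (g \<otimes> a) \<otimes> (g \<otimes> a) \<otimes> p"
    using regular_in_square I_l_closed[OF aI gc] by blast
  have "e = (e \<otimes> g) \<otimes> a \<otimes> s" using eg ac ec sc as ee by (simp add: m_assoc)
  also have "\<dots> = e \<otimes> (g \<otimes> a) \<otimes> s" using gc ac ec by (simp add: m_assoc)
  also have "\<dots> = e \<otimes> ((g \<otimes> a) \<otimes> (g \<otimes> a) \<otimes> p) \<otimes> s" using p(2) by simp
  also have "\<dots> = (e \<otimes> g) \<otimes> (a \<otimes> (g \<otimes> (a \<otimes> (p \<otimes> s))))"
    using gc ac ec p(1) sc by (simp add: m_assoc)
  also have "\<dots> = e \<otimes> (a \<otimes> a) \<otimes> (t \<otimes> (a \<otimes> (p \<otimes> s)))"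
    using eg ac tc ec p(1) sc unfolding g_def by (simp add: m_assoc)
  finally show ?thesis using tc ac p(1) sc by (metis m_closed)
qed

text \<open>
  In block form with respect to \<open>e\<close> and \<open>1 - e\<close> the element is upper triangular, with diagonal
  \<open>(de, 1)\<close>. It factors as the diagonal part times a unipotent element, so that it is enough
  to invert \<open>de\<close> in \<open>eRe\<close>.
\<close>

lemma complete_to_unit:
  assumes eI: "e \<in> I" and ee: "e \<otimes> e = e" and dc: "d \<in> carrier R" and ed: "e \<otimes> d = d"
    and zc: "z \<in> carrier R" and dz: "d \<otimes> z = e"
  shows "d \<oplus> (\<one> \<ominus> e) \<in> Units R"
proof -
  have ec: "e \<in> carrier R" using eI a_subset by blast
  have dI: "d \<in> I" using I_r_closed[OF eI dc] ed by simp
  have "d = d \<otimes> z \<otimes> d" using dz ed by simp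
  then have "ring_regular R d" using dc zc unfolding ring_regular_def by blast
  then obtain p where p: "p \<in> carrier R" "d = d \<otimes> d \<otimes> p" using regular_in_square dI by blast
  define \<alpha> where "\<alpha> = d \<otimes> e"
  \<comment> \<open>\<open>\<beta>\<close> is read off from \<open>e = dz = d\<^sup>2pz = (de)(dpz)\<close>.\<close>
  define \<beta> where "\<beta> = d \<otimes> (p \<otimes> (z \<otimes> e))"
  define k where "k = \<one> \<ominus> e"
  have ac: "\<alpha> \<in> carrier R" and bc: "\<beta> \<in> carrier R" and kc: "k \<in> carrier R"
    using dc ec p(1) zc unfolding \<alpha>_def \<beta>_def k_def by auto
  have ae: "\<alpha> \<otimes> e = \<alpha>" and be: "\<beta> \<otimes> e = \<beta>"
    using dc ec p(1) zc ee unfolding \<alpha>_def \<beta>_def by (simp_all add: m_assoc)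
  have ea: "e \<otimes> \<alpha> = \<alpha>" and eb: "e \<otimes> \<beta> = \<beta>"
    using dc ec p(1) zc ed unfolding \<alpha>_def \<beta>_def by (metis m_assoc m_closed)+
  have ab: "\<alpha> \<otimes> \<beta> = e"
  proof -
    have "\<alpha> \<otimes> \<beta> = d \<otimes> ((e \<otimes> d) \<otimes> (p \<otimes> (z \<otimes> e)))"
      using dc ec p(1) zc unfolding \<alpha>_def \<beta>_def by (simp add: m_assoc)
    also have "\<dots> = (d \<otimes> d \<otimes> p) \<otimes> (z \<otimes> e)" using dc ec p(1) zc ed by (simp add: m_assoc)
    also have "\<dots> = d \<otimes> z \<otimes> e" using p(2) dc zc ec by (simp add: m_assoc)
    finally show ?thesis using dz ee by simp
  qed
  have ba: "\<beta> \<otimes> \<alpha> = e" using corner_dedekind_finite[OF eI ac bc ae eb be ab] .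
  have ek: "e \<otimes> k = \<zero>" and ke: "k \<otimes> e = \<zero>" and kk: "k \<otimes> k = k"
    using idempotent_one_minus[OF ec ee] unfolding k_def by auto
  have kill: "\<alpha> \<otimes> k = \<zero>" "\<beta> \<otimes> k = \<zero>" "k \<otimes> \<alpha> = \<zero>" "k \<otimes> \<beta> = \<zero>"
    using ae be ea eb ek ke ac bc ec kc by (metis m_assoc l_null r_null)+
  have eplusk: "e \<oplus> k = \<one>" unfolding k_def using add_one_minus[OF ec] .
  have diag: "\<alpha> \<oplus> k \<in> Units R"
    unfolding Units_def using ac bc kc ab ba kill kk eplusk
    by (auto simp: r_distr l_distr intro!: bexI[of _ "\<beta> \<oplus> k"])
  \<comment> \<open>The factor \<open>\<beta>\<close> is needed because multiplication by the diagonal part turns \<open>n\<close> into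
    the off-diagonal block \<open>d(1 - e)\<close>.\<close>
  define n where "n = \<beta> \<otimes> (d \<otimes> k)"
  have nc: "n \<in> carrier R" using bc dc kc unfolding n_def by simp
  have kb: "k \<otimes> (\<beta> \<otimes> y) = \<zero>" if "y \<in> carrier R" for y
    using that kill kc bc by (metis m_assoc l_null)
  have nn: "n \<otimes> n = \<zero>"
    using bc dc kc kb unfolding n_def by (simp add: m_assoc)
  have tri: "\<one> \<oplus> n \<in> Units R"
    unfolding Units_def using nc nn
    by (auto simp: a_minus_def r_distr l_distr r_minus l_minus r_neg l_neg a_assoc
        intro!: bexI[of _ "\<one> \<ominus> n"])
  have "\<alpha> \<otimes> n = d \<otimes> k"
    using ab ac bc dc kc ed unfolding n_def by (metis m_assoc m_closed)
  then have "(\<alpha> \<oplus> k) \<otimes> (\<one> \<oplus> n) = (\<alpha> \<oplus> d \<otimes> k) \<oplus> k"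
    using ac kc nc kb dc unfolding n_def
    by (simp add: l_distr r_distr a_assoc a_comm a_lcomm)
  also have "\<alpha> \<oplus> d \<otimes> k = d"
    using eplusk dc ec kc unfolding \<alpha>_def by (metis r_distr r_one)
  finally show ?thesis using diag tri unfolding k_def by (metis Units_m_closed)
qed

end

section \<open>Square stability\<close>

text \<open>
  The comaximal pair to test is \<open>a\<close> together with \<open>1 - ax\<close>, because left multiplication by
  \<open>ax\<close> fixes \<open>a\<close> and annihilates \<open>1 - ax\<close>.
\<close>

lemma (in ideal) square_stable_regular_in_square:
  assumes st: "square_stable R I" and aI: "a \<in> I" and reg: "ring_regular R a"
  shows "\<exists>r\<in>carrier R. a = a \<otimes> a \<otimes> r"
proof -
  have ac: "a \<in> carrier R" using aI a_subset by blast
  obtain x where x: "x \<in> carrier R" "a = a \<otimes> x \<otimes> a" using reg unfolding ring_regular_def by blast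
  define e where "e = a \<otimes> x"
  have ec: "e \<in> carrier R" using ac x(1) unfolding e_def by simp
  have ea: "e \<otimes> a = a" using x unfolding e_def by simp
  have ee: "e \<otimes> e = e" using ea ac ec x(1) unfolding e_def by (metis m_assoc)
  have "\<one> = a \<otimes> x \<oplus> (\<one> \<ominus> e) \<otimes> \<one>"
    using add_one_minus[OF ec] ec unfolding e_def[symmetric] by simp
  then have "(a <# carrier R) <+> ((\<one> \<ominus> e) <# carrier R) = carrier R"
    using right_ideals_comaximal_iff[OF ac, of "\<one> \<ominus> e"] ec x(1)
    by (metis minus_closed one_closed)
  then obtain y where y: "y \<in> carrier R" and u: "a \<otimes> a \<oplus> (\<one> \<ominus> e) \<otimes> y \<in> Units R" (is "?u \<in> _")
    using st aI ec unfolding square_stable_def by (meson minus_closed one_closed)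
  have uc: "?u \<in> carrier R" using Units_closed[OF u] .
  have "e \<otimes> ((\<one> \<ominus> e) \<otimes> y) = \<zero>"
    using idempotent_one_minus(1)[OF ec ee] ec y by (metis l_null m_assoc minus_closed one_closed)
  moreover have "e \<otimes> (a \<otimes> a) = a \<otimes> a" using ea ec ac by (metis m_assoc)
  ultimately have eu: "e \<otimes> ?u = a \<otimes> a" using ec ac y by (simp add: r_distr)
  have "a = e \<otimes> (?u \<otimes> inv ?u) \<otimes> a" using u ea ec by simp
  also have "\<dots> = (e \<otimes> ?u) \<otimes> (inv ?u \<otimes> a)" using ec uc u ac by (simp only: m_assoc Units_inv_closed m_closed)
  finally show ?thesis using eu u ac by (metis Units_inv_closed m_closed)
qed

text \<open>
  The identity \<open>e = a + y - ay\<close> is equivalent to \<open>1 - e = (1 - a)(1 - y)\<close>.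
\<close>

lemma (in exchange_ideal) exchange_suitable:
  assumes aI: "a \<in> I"
  shows "\<exists>e x z. e \<in> I \<and> x \<in> carrier R \<and> z \<in> carrier R \<and> e \<otimes> e = e \<and> e = a \<otimes> x \<and>
    \<one> \<ominus> e = (\<one> \<ominus> a) \<otimes> z"
proof -
  obtain e x y where *: "e \<in> I" "x \<in> I" "y \<in> I" "e \<otimes> e = e" "e = a \<otimes> x" "a \<otimes> x = a \<oplus> y \<ominus> a \<otimes> y"
    using exchange[OF aI] unfolding ring_idempotent_def by blast
  have c: "a \<in> carrier R" "x \<in> carrier R" "y \<in> carrier R" using * aI a_subset by blast+
  have "\<one> \<ominus> (a \<oplus> y \<ominus> a \<otimes> y) = (\<one> \<ominus> a) \<otimes> (\<one> \<ominus> y)"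
    using c by (simp add: a_minus_def r_distr l_distr r_minus l_minus minus_add a_ac)
  then show ?thesis using * c by (metis minus_closed one_closed)
qed

text \<open>
  Exchange replaces the equation \<open>ax + by = 1\<close> by one in which the summands are orthogonal
  idempotents \<open>e\<close> and \<open>1 - e\<close>, and then the unit \<open>ea\<^sup>2 + (1 - e)\<close> is congruent to
  \<open>a\<^sup>2\<close> modulo \<open>(1 - e)R \<subseteq> bR\<close>.
\<close>

lemma square_stable_if_regulars_square_divisible:
  fixes R (structure)
  assumes "exchange_ideal I R" and "regulars_square_divisible I R"
  shows "square_stable R I"
  unfolding square_stable_def
proof (intro ballI impI)
  interpret exchange_ideal I R by fact
  interpret regulars_square_divisible I R by fact
  fix a b
  assume aI: "a \<in> I" and bc: "b \<in> carrier R"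
    and "(a <# carrier R) <+> (b <# carrier R) = carrier R"
  have ac: "a \<in> carrier R" using aI a_subset by blast
  then obtain x y where x: "x \<in> carrier R" and y: "y \<in> carrier R" and "\<one> = a \<otimes> x \<oplus> b \<otimes> y"
    using right_ideals_comaximal_iff[OF ac bc] \<open>_ = carrier R\<close> by blast
  then have "\<one> = b \<otimes> y \<oplus> a \<otimes> x" using ac bc by (simp add: a_comm)
  then have by_eq: "\<one> \<ominus> a \<otimes> x = b \<otimes> y"
    using ac bc x y by (simp add: a_minus_def a_assoc r_neg)
  obtain e s t where eI: "e \<in> I" and s: "s \<in> carrier R" and t: "t \<in> carrier R" and ee: "e \<otimes> e = e"
      and es: "e = a \<otimes> x \<otimes> s" and et: "\<one> \<ominus> e = (\<one> \<ominus> a \<otimes> x) \<otimes> t"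
    using exchange_suitable[OF I_r_closed[OF aI x]] by blast
  have ec: "e \<in> carrier R" using eI a_subset by blast
  obtain z where z: "z \<in> carrier R" "e \<otimes> (a \<otimes> a) \<otimes> z = e"
    using idempotent_in_square[OF aI ec ee, of "x \<otimes> s"] es ac x s by (auto simp: m_assoc)
  have "e \<otimes> (e \<otimes> (a \<otimes> a)) = e \<otimes> (a \<otimes> a)" using ee ec ac by (metis m_assoc m_closed)
  then have u: "e \<otimes> (a \<otimes> a) \<oplus> (\<one> \<ominus> e) \<in> Units R"
    using complete_to_unit[OF eI ee _ _ z(1) z(2)] ec ac by simp
  define q where "q = y \<otimes> (t \<otimes> (\<one> \<ominus> a \<otimes> a))"
  have qc: "q \<in> carrier R" using y t ac unfolding q_def by simp
  have "b \<otimes> q = (\<one> \<ominus> e) \<otimes> (\<one> \<ominus> a \<otimes> a)"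
    using by_eq et bc y t ac unfolding q_def by (simp add: m_assoc)
  then have "a \<otimes> a \<oplus> b \<otimes> q = a \<otimes> a \<oplus> (\<one> \<ominus> e) \<otimes> (\<one> \<ominus> a \<otimes> a)" by simp
  also have "\<dots> = e \<otimes> (a \<otimes> a) \<oplus> (\<one> \<ominus> e)"
    using ac ec by (simp add: a_minus_def r_distr l_distr r_minus l_minus minus_add a_ac r_neg1 r_neg2)
  finally show "\<exists>y\<in>carrier R. a \<otimes> a \<oplus> b \<otimes> y \<in> Units R" using u qc by metis
qed

theorem theorem2p9:
  fixes R :: "('a, 'm) ring_scheme" and I :: "'a set"
  assumes "ring R"
    and "exchange_ideal I R"
  shows "(square_stable R I \<longleftrightarrow>
            (\<forall>a\<in>I. ring_regular R a \<longrightarrow>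
               a \<in> (a \<otimes>\<^bsub>R\<^esub> a) <#\<^bsub>R\<^esub> carrier R \<and>
               dedekind_finite_module R (principal_right_module R a))) \<and>
         ((\<forall>a\<in>I. ring_regular R a \<longrightarrow>
               a \<in> (a \<otimes>\<^bsub>R\<^esub> a) <#\<^bsub>R\<^esub> carrier R \<and>
               dedekind_finite_module R (principal_right_module R a)) \<longleftrightarrow>
            (\<forall>a\<in>I. ring_regular R a \<longrightarrow> strongly_regular R a))"
    (is "(_ \<longleftrightarrow> ?two) \<and> (_ \<longleftrightarrow> ?three)")
proof -
  interpret exchange_ideal I R by fact
  let ?P = "regulars_square_divisible I R"
  have P_iff: "?P \<longleftrightarrow> (\<forall>a\<in>I. ring_regular R a \<longrightarrow> a \<in> (a \<otimes>\<^bsub>R\<^esub> a) <#\<^bsub>R\<^esub> carrier R)"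
    using ideal_axioms
    by (auto simp: regulars_square_divisible_def regulars_square_divisible_axioms_def
        mem_l_coset_carrier_iff)
  have "square_stable R I \<longleftrightarrow> ?P"
    using square_stable_if_regulars_square_divisible[OF assms(2)] square_stable_regular_in_square
    unfolding P_iff mem_l_coset_carrier_iff by blast
  moreover have "?two \<longleftrightarrow> ?P"
  proof
    show ?P if ?two
      using that unfolding P_iff by blast
    show ?two if P: ?P
      using P[unfolded P_iff] regulars_square_divisible.dedekind_finite_principal[OF P] by blast
  qed
  moreover have "?three \<longleftrightarrow> ?P"
  proof
    show ?P if ?three
      using that unfolding P_iff strongly_regular_def by blast
    show ?three if P: ?P
      using P[unfolded P_iff] regulars_square_divisible.regular_in_left_square[OF P]
      by (simp add: strongly_regular_def mem_r_coset_carrier_iff ring_regular_def)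
  qed
  ultimately show ?thesis by blast
qed

end
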